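(* Let $G=(V,E)$ be a finite graph, $\ell\colon E\to(0,+\infty)$ an edge length function, $\Gamma$ the corresponding metric graph, $D$ a divisor on $\Gamma$, and $f\colon V\to\mathbb{R}$ a function. There is a unique rational function $\hat f\colon\Gamma\to\mathbb{R}$ extending $f$ such that $D+\mathrm{div}(\hat f)$ is $G$-admissible. Moreover, letting $\tau=\tau^D$ be the twister function of $D$, the function $\hat f$ is characterized (among rational functions on $\Gamma$ extending $f$) by the following properties: (1) The incoming slope of $\hat f$ at each $u\in V$ along an oriented edge $e$ with tail $\mathrm{t}_e=u$ is $\Big\lfloor\frac{f(\mathrm{t}_e)-f(\mathrm{h}_e)+\tau(e)}{\ell_e}\Big\rfloor$. (2) For each oriented edge $e$ of $G$ and $t\in(0,\ell_e)$, the divisor $D+\mathrm{div}(\hat f)$ takes value $0$ at $x^e_t$, unless $\ell_e-t$ is the remainder of the Euclidean division of $f(\mathrm{t}_e)-f(\mathrm{h}_e)+\tau(e)$ by $\ell_e$, in which case it takes value $1$.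
   Context: The metric graph $\Gamma$ is obtained from $G$ by replacing each edge $e$ by an interval of length $\ell_e=\ell(e)$. An oriented edge $e$ has tail $\mathrm{t}_e$ and head $\mathrm{h}_e$; it is identified with $[0,\ell_e]$, $0$ corresponding to $\mathrm{t}_e$ and $\ell_e$ to $\mathrm{h}_e$, and $x^e_t$ is the point at distance $t$ from $\mathrm{t}_e$ on $e$. The interior of $e$ is the set of $x_t^e$ with $0<t<\ell_e$. A divisor on $\Gamma$ is a finite formal sum $D=\sum_{x\in\Gamma}D(x)(x)$ with $D(x)\in\mathbb{Z}$. It is $G$-admissible if for each edge $e$, $D$ vanishes at every point of the interior of $e$ with at most one exception $x$, for which $D(x)=1$. A rational function on $\Gamma$ is a continuous function $\Gamma\to\mathbb{R}$ whose restriction to each edge is piecewise affine with integral slopes. The order $\mathrm{ord}_x(h)$ is the sum of the incoming slopes of $h$ at $x$ (the incoming slope along a tangent direction at $x$ is the slope of $h$ when moving towards $x$ along that direction, i.e. minus the outgoing slope), and $\mathrm{div}(h)=\sum_x\mathrm{ord}_x(h)(x)$. Twister function: for each oriented edge $e$, $\tau^D(e):=\sum_{t\in(0,\ell_e)}(\ell_e-t)D(x^e_t)$. The remainder of the Euclidean division of a real number $y$ by a positive real number $x$ is $y-\lfloor y/x\rfloor x$. *)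

theory Defs
  imports
    "HOL-Analysis.Analysis"
    "HOL-Library.Real_Mod"
    "Graph_Theory.Bidirected_Digraph"
begin

text \<open>
  A finite graph (loops and multiple edges allowed) is given by its vertices and its oriented
  edges: a finite digraph \<open>G\<close> with a fixed-point free involution \<open>arev\<close> of the arcs that exchanges
  tail and head. An edge is a pair \<open>{e, arev e}\<close>, and an edge length function is
  a function \<open>len\<close> on arcs with \<open>len (arev e) = len e\<close>.
\<close>

section \<open>The metric graph\<close>

text \<open>
  An interior point of an edge is the class of its two descriptions \<open>(e, t)\<close> and
  \<open>(arev e, len e - t)\<close>, one for each orientation.
\<close>

datatype ('a, 'b) mpoint = Vertex 'a | Inner "('b \<times> real) set"

definition pt ::
  "('a, 'b) pre_digraph \<Rightarrow> ('b \<Rightarrow> 'b) \<Rightarrow> ('b \<Rightarrow> real) \<Rightarrow> 'b \<Rightarrow> real \<Rightarrow> ('a, 'b) mpoint" where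
  "pt G arev len e t =
     (if t = 0 then Vertex (tail G e)
      else if t = len e then Vertex (head G e)
      else Inner {(e, t), (arev e, len e - t)})"

definition mpoints ::
  "('a, 'b) pre_digraph \<Rightarrow> ('b \<Rightarrow> 'b) \<Rightarrow> ('b \<Rightarrow> real) \<Rightarrow> ('a, 'b) mpoint set" where
  "mpoints G arev len =
     Vertex ` verts G \<union> (\<Union>e\<in>arcs G. pt G arev len e ` {0..len e})"

definition edge_interior ::
  "('a, 'b) pre_digraph \<Rightarrow> ('b \<Rightarrow> 'b) \<Rightarrow> ('b \<Rightarrow> real) \<Rightarrow> 'b \<Rightarrow> ('a, 'b) mpoint set" where
  "edge_interior G arev len e = pt G arev len e ` {0<..<len e}"

text \<open>
  The topology obtained by gluing the intervals \<open>{0..len e}\<close> at the vertices. As the graph is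
  finite, it is the topology of the path metric.
\<close>

definition mtopology ::
  "('a, 'b) pre_digraph \<Rightarrow> ('b \<Rightarrow> 'b) \<Rightarrow> ('b \<Rightarrow> real) \<Rightarrow> ('a, 'b) mpoint topology" where
  "mtopology G arev len = topology (\<lambda>U. U \<subseteq> mpoints G arev len \<and>
     (\<forall>e\<in>arcs G. openin (top_of_set {0..len e}) {t \<in> {0..len e}. pt G arev len e t \<in> U}))"

lemma openin_mtopology:
  "openin (mtopology G arev len) U \<longleftrightarrow> U \<subseteq> mpoints G arev len \<and>
     (\<forall>e\<in>arcs G. openin (top_of_set {0..len e}) {t \<in> {0..len e}. pt G arev len e t \<in> U})"
proof -
  let ?P = "\<lambda>e U. {t \<in> {0..len e}. pt G arev len e t \<in> U}"
  have inter: "?P e (S \<inter> T) = ?P e S \<inter> ?P e T" for e S T by auto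
  have union: "?P e (\<Union>K) = \<Union>(?P e ` K)" for e K by auto
  have "istopology (\<lambda>U. U \<subseteq> mpoints G arev len \<and>
     (\<forall>e\<in>arcs G. openin (top_of_set {0..len e}) (?P e U)))"
    unfolding istopology_def inter union by (auto intro!: openin_Int openin_Union)
  then show ?thesis
    by (simp add: mtopology_def topology_inverse')
qed

lemma topspace_mtopology [simp]: "topspace (mtopology G arev len) = mpoints G arev len"
proof
  show "topspace (mtopology G arev len) \<subseteq> mpoints G arev len"
    using openin_mtopology[of G arev len "topspace (mtopology G arev len)"] by simp
  have "{t \<in> {0..len e}. pt G arev len e t \<in> mpoints G arev len} = {0..len e}"
    if "e \<in> arcs G" for e
    using that by (auto simp: mpoints_def)
  then have "openin (mtopology G arev len) (mpoints G arev len)"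
    unfolding openin_mtopology by simp
  then show "mpoints G arev len \<subseteq> topspace (mtopology G arev len)"
    by (rule openin_subset)
qed

section \<open>Divisors and the twister function\<close>

definition mdivisor ::
  "('a, 'b) pre_digraph \<Rightarrow> ('b \<Rightarrow> 'b) \<Rightarrow> ('b \<Rightarrow> real) \<Rightarrow> (('a, 'b) mpoint \<Rightarrow> int) \<Rightarrow> bool" where
  "mdivisor G arev len D \<longleftrightarrow> finite {x. D x \<noteq> 0} \<and> {x. D x \<noteq> 0} \<subseteq> mpoints G arev len"

definition admissible ::
  "('a, 'b) pre_digraph \<Rightarrow> ('b \<Rightarrow> 'b) \<Rightarrow> ('b \<Rightarrow> real) \<Rightarrow> (('a, 'b) mpoint \<Rightarrow> int) \<Rightarrow> bool" where
  "admissible G arev len D \<longleftrightarrow> mdivisor G arev len D \<and>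
     (\<forall>e\<in>arcs G. (\<forall>x\<in>edge_interior G arev len e. D x = 0) \<or>
        (\<exists>x\<in>edge_interior G arev len e. D x = 1 \<and>
           (\<forall>y\<in>edge_interior G arev len e - {x}. D y = 0)))"

definition twister ::
  "('a, 'b) pre_digraph \<Rightarrow> ('b \<Rightarrow> 'b) \<Rightarrow> ('b \<Rightarrow> real) \<Rightarrow> (('a, 'b) mpoint \<Rightarrow> int) \<Rightarrow> 'b \<Rightarrow> real" where
  "twister G arev len D e =
     (\<Sum>t \<in> {t \<in> {0<..<len e}. D (pt G arev len e t) \<noteq> 0}.
        (len e - t) * of_int (D (pt G arev len e t)))"

section \<open>Rational functions\<close>

definition piecewise_integral_affine :: "real \<Rightarrow> (real \<Rightarrow> real) \<Rightarrow> bool" where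
  "piecewise_integral_affine l g \<longleftrightarrow>
     (\<exists>(n::nat) (s :: nat \<Rightarrow> real). s 0 = 0 \<and> s n = l \<and>
        (\<forall>i<n. s i < s (Suc i) \<and>
           (\<exists>k::int. \<forall>t\<in>{s i..s (Suc i)}. g t = g (s i) + of_int k * (t - s i))))"

text \<open>
  Functions on the metric graph are represented by functions on the type of points that are
  \<open>undefined\<close> outside the metric graph, so that equality is equality on the metric graph.
\<close>

definition rational_functions ::
  "('a, 'b) pre_digraph \<Rightarrow> ('b \<Rightarrow> 'b) \<Rightarrow> ('b \<Rightarrow> real) \<Rightarrow> (('a, 'b) mpoint \<Rightarrow> real) set" where
  "rational_functions G arev len =
     {h \<in> extensional (mpoints G arev len).
        continuous_map (mtopology G arev len) euclideanreal h \<and>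
        (\<forall>e\<in>arcs G. piecewise_integral_affine (len e) (\<lambda>t. h (pt G arev len e t)))}"

text \<open>
  The incoming slope of \<open>h\<close> at the point at distance \<open>t < len e\<close> from the tail of \<open>e\<close>, along the
  tangent direction pointing towards the head of \<open>e\<close>. It is meant for rational functions \<open>h\<close>.
\<close>

definition incoming_slope ::
  "('a, 'b) pre_digraph \<Rightarrow> ('b \<Rightarrow> 'b) \<Rightarrow> ('b \<Rightarrow> real) \<Rightarrow> (('a, 'b) mpoint \<Rightarrow> real) \<Rightarrow> 'b \<Rightarrow> real \<Rightarrow> int"
  where
  "incoming_slope G arev len h e t =
     (THE k. \<forall>\<^sub>F s in at_right t.
        h (pt G arev len e t) - h (pt G arev len e s) = of_int k * (s - t))"

text \<open>
  The tangent directions at \<open>x\<close>. At a vertex these are the pairs \<open>(e, 0)\<close> with \<open>e\<close> leaving \<open>x\<close>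
  (a loop contributes both orientations); at an interior point they are the two pairs of its class.
\<close>

definition tangent_directions ::
  "('a, 'b) pre_digraph \<Rightarrow> ('b \<Rightarrow> 'b) \<Rightarrow> ('b \<Rightarrow> real) \<Rightarrow> ('a, 'b) mpoint \<Rightarrow> ('b \<times> real) set" where
  "tangent_directions G arev len x =
     {(e, t). e \<in> arcs G \<and> 0 \<le> t \<and> t < len e \<and> pt G arev len e t = x}"

definition ord_at ::
  "('a, 'b) pre_digraph \<Rightarrow> ('b \<Rightarrow> 'b) \<Rightarrow> ('b \<Rightarrow> real) \<Rightarrow> (('a, 'b) mpoint \<Rightarrow> real) \<Rightarrow>
     ('a, 'b) mpoint \<Rightarrow> int" where
  "ord_at G arev len h x =
     (\<Sum>(e, t)\<in>tangent_directions G arev len x. incoming_slope G arev len h e t)"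

text \<open>Outside the metric graph, there are no tangent directions and the value is 0.\<close>

definition divisor_of ::
  "('a, 'b) pre_digraph \<Rightarrow> ('b \<Rightarrow> 'b) \<Rightarrow> ('b \<Rightarrow> real) \<Rightarrow> (('a, 'b) mpoint \<Rightarrow> real) \<Rightarrow>
     ('a, 'b) mpoint \<Rightarrow> int" where
  "divisor_of G arev len h = (\<lambda>x. ord_at G arev len h x)"

definition extends ::
  "('a, 'b) pre_digraph \<Rightarrow> ('a \<Rightarrow> real) \<Rightarrow> (('a, 'b) mpoint \<Rightarrow> real) \<Rightarrow> bool" where
  "extends G f h \<longleftrightarrow> (\<forall>v\<in>verts G. h (Vertex v) = f v)"

end

theory Submission
  imports Defs
begin

text \<open>
  The problem decouples over the edges, because \<open>f\<close> prescribes the values at the vertices and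
  admissibility only concerns the interiors of the edges. On an edge of length \<open>l\<close>, identified with
  \<open>{0..l}\<close>, a piecewise affine function \<open>g\<close> is determined by its value and its incoming slope \<open>k\<close>
  at \<open>0\<close> and by its orders at interior points, here called bends:
  \<open>g t = g 0 - k * t - (\<Sum>s. bend s * max 0 (t - s))\<close>.
  Evaluating this at \<open>t = l\<close> and adding the twister \<open>\<tau> = (\<Sum>s. (l - s) * D s)\<close> to both sides gives
  the identity that carries the proof (\<open>twisted_drop_eq\<close>):
  \<open>g 0 - g l + \<tau> = k * l + (\<Sum>s. (l - s) * (D s + bend s))\<close>.

  If \<open>D + bend\<close> is admissible, the last sum is either \<open>0\<close> or a single number \<open>l - s\<close> with
  \<open>0 < l - s < l\<close>. In both cases the right-hand side is a division with remainder by \<open>l\<close>: the slope \<open>k\<close>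
  is the quotient, and the sum is the remainder, which tells whether and where \<open>D + bend\<close> takes the
  value \<open>1\<close> (\<open>edge_admissible_imp\<close>). So the boundary values and \<open>D\<close> determine
  all bends, hence \<open>g\<close> (\<open>edge_unique\<close>). Conversely, the function with the slope and
  the bends dictated by the division has the right boundary values (\<open>edge_exists\<close>). The two
  properties in the theorem are the quotient and the remainder of this division, and a divisor given
  by the remainder is admissible (\<open>edge_admissible_remainder\<close>), so uniqueness makes them
  a characterization.

  On the metric graph each edge has two orientations, and the solutions for both have to be mirror
  images of each other before they can be glued (\<open>glue_edge_functions\<close>). This follows from uniqueness:
  the mirror image of a solution for one orientation solves the problem for the other one.
\<close>

section \<open>Slopes and bends of functions on an interval\<close>

text \<open>
  On an edge these are the incoming slope of a function on the metric graph and its order at an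
  interior point, expressed by the restriction of the function to the edge. The direction towards the
  tail of the edge is accounted for by reversing the interval.
\<close>

definition in_slope :: "(real \<Rightarrow> real) \<Rightarrow> real \<Rightarrow> int" where
  "in_slope g t = (THE k. \<forall>\<^sub>F s in at_right t. g t - g s = of_int k * (s - t))"

definition bend :: "real \<Rightarrow> (real \<Rightarrow> real) \<Rightarrow> real \<Rightarrow> int" where
  "bend l g t = in_slope g t + in_slope (\<lambda>s. g (l - s)) (l - t)"

lemma bend_reverse: "bend l (\<lambda>s. g (l - s)) (l - t) = bend l g t"
  by (simp add: bend_def)

lemma in_slope_eqI:
  assumes "\<forall>\<^sub>F s in at_right t. g t - g s = of_int k * (s - t)"
  shows "in_slope g t = k"
  unfolding in_slope_def
proof (rule the_equality[where P = "\<lambda>k. \<forall>\<^sub>F s in at_right t. g t - g s = of_int k * (s - t)", OF assms])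
  fix k' :: int
  assume "\<forall>\<^sub>F s in at_right t. g t - g s = of_int k' * (s - t)"
  with assms have "\<forall>\<^sub>F s in at_right t. k' = k"
    using eventually_at_right_less[of t]
    by eventually_elim auto
  then show "k' = k"
    by simp
qed

lemma in_slope_cong:
  assumes "t < l" "\<And>s. s \<in> {t..l} \<Longrightarrow> g s = g' s"
  shows "in_slope g t = in_slope g' t"
proof -
  have "\<forall>\<^sub>F s in at_right t. s \<in> {t<..<l}"
    using assms(1) by (intro eventually_at_rightI) auto
  then have "\<forall>\<^sub>F s in at_right t. g s = g' s"
    by eventually_elim (use assms in auto)
  then have "\<forall>\<^sub>F s in at_right t.
      (g t - g s = of_int k * (s - t)) = (g' t - g' s = of_int k * (s - t))" for k :: int
    by eventually_elim (use assms in auto)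
  then have "(\<forall>\<^sub>F s in at_right t. g t - g s = of_int k * (s - t)) \<longleftrightarrow>
      (\<forall>\<^sub>F s in at_right t. g' t - g' s = of_int k * (s - t))" for k :: int
    by (rule eventually_subst)
  then show ?thesis
    by (simp add: in_slope_def)
qed

lemma bend_cong:
  assumes "0 < t" "t < l" "\<And>s. s \<in> {0..l} \<Longrightarrow> g s = g' s"
  shows "bend l g t = bend l g' t"
  unfolding bend_def using assms by (intro arg_cong2[of _ _ _ _ "(+)"] in_slope_cong[where l = l]) auto

text \<open>
  For positive breakpoints \<open>S\<close>, the function with value \<open>a\<close> and outgoing slope \<open>-k\<close> at \<open>0\<close>
  whose slope drops by \<open>c s\<close> at each \<open>s \<in> S\<close>. The parameters are the quantities of interest, and breakpoints can be added freely with
  \<open>c s = 0\<close>, so that several functions and divisors can share one finite set \<open>S\<close>.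
\<close>

definition broken_line :: "real \<Rightarrow> int \<Rightarrow> real set \<Rightarrow> (real \<Rightarrow> int) \<Rightarrow> real \<Rightarrow> real" where
  "broken_line a k S c t = a - of_int k * t - (\<Sum>s\<in>S. of_int (c s) * max 0 (t - s))"

lemma continuous_on_broken_line: "continuous_on A (broken_line a k S c)"
  unfolding broken_line_def by (intro continuous_intros)

lemma broken_line_mono_neutral:
  assumes "finite S'" "S \<subseteq> S'" "\<And>s. s \<in> S' - S \<Longrightarrow> c s = 0"
  shows "broken_line a k S' c t = broken_line a k S c t"
  unfolding broken_line_def using assms
  by (subst sum.mono_neutral_left[of S' S]) auto

lemma broken_line_cong:
  assumes "\<And>s. s \<in> S \<Longrightarrow> c s = c' s"
  shows "broken_line a k S c t = broken_line a k S c' t"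
  using assms by (simp add: broken_line_def)

text \<open>
  Between two consecutive breakpoints a broken line is affine, with the slope accumulated so far. Both
  one-sided slopes and the conversion into affine pieces are read off from this.
\<close>

lemma broken_line_diff:
  assumes "finite S" "t \<le> u" "\<And>s. s \<in> S \<Longrightarrow> s \<le> t \<or> u \<le> s"
  shows "broken_line a k S c t - broken_line a k S c u =
    of_int (k + (\<Sum>s\<in>{s\<in>S. s \<le> t}. c s)) * (u - t)"
proof -
  have "(\<Sum>s\<in>S. of_int (c s) * max 0 (u - s)) - (\<Sum>s\<in>S. of_int (c s) * max 0 (t - s)) =
      (\<Sum>s\<in>S. if s \<le> t then of_int (c s) * (u - t) else 0)"
    unfolding sum_subtractf[symmetric]
  proof (rule sum.cong)
    fix s assume "s \<in> S"
    with assms(2) assms(3)[of s]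
    show "of_int (c s) * max 0 (u - s) - of_int (c s) * max 0 (t - s) =
        (if s \<le> t then of_int (c s) * (u - t) else 0)"
      by (auto simp: max_def algebra_simps)
  qed simp
  also have "\<dots> = of_int (\<Sum>s\<in>{s\<in>S. s \<le> t}. c s) * (u - t)"
    using assms(1) by (simp add: sum.If_cases Int_def sum_distrib_right)
  finally show ?thesis
    by (simp add: broken_line_def algebra_simps)
qed

lemma in_slope_broken_line:
  assumes S: "finite S" and t: "0 \<le> t" "t < l"
    and g: "\<And>t. t \<in> {0..l} \<Longrightarrow> g t = broken_line a k S c t"
  shows "in_slope g t = k + (\<Sum>s\<in>{s\<in>S. s \<le> t}. c s)"
proof (rule in_slope_eqI)
  have "\<forall>\<^sub>F u in at_right t. s \<le> t \<or> u \<le> s" for s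
  proof (cases "s \<le> t")
    case False
    then have "\<forall>\<^sub>F u in at_right t. u \<le> s"
      by (auto intro: eventually_at_rightI[of t s])
    then show ?thesis
      by eventually_elim simp
  qed simp
  then have "\<forall>\<^sub>F u in at_right t. \<forall>s\<in>S. s \<le> t \<or> u \<le> s"
    using S by (simp add: eventually_ball_finite)
  moreover have "\<forall>\<^sub>F u in at_right t. u \<in> {t<..<l}"
    using t by (intro eventually_at_rightI) auto
  ultimately show "\<forall>\<^sub>F u in at_right t.
      g t - g u = of_int (k + (\<Sum>s\<in>{s\<in>S. s \<le> t}. c s)) * (u - t)"
  proof eventually_elim
    case (elim u)
    with t show ?case
      using broken_line_diff[OF S, of t u a k c] by (simp add: g)
  qed
qed

lemma in_slope_reverse_broken_line:
  assumes S: "finite S" and t: "0 < t" "t \<le> l"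
    and g: "\<And>t. t \<in> {0..l} \<Longrightarrow> g t = broken_line a k S c t"
  shows "in_slope (\<lambda>s. g (l - s)) (l - t) = - (k + (\<Sum>s\<in>{s\<in>S. s < t}. c s))"
proof (rule in_slope_eqI)
  have "\<forall>\<^sub>F u in at_right (l - t). s \<le> l - u \<or> t \<le> s" for s
  proof (cases "t \<le> s")
    case False
    then have "\<forall>\<^sub>F u in at_right (l - t). s \<le> l - u"
      by (auto intro: eventually_at_rightI[of "l - t" "l - s"])
    then show ?thesis
      by eventually_elim simp
  qed simp
  then have "\<forall>\<^sub>F u in at_right (l - t). \<forall>s\<in>S. s \<le> l - u \<or> t \<le> s"
    using S by (simp add: eventually_ball_finite)
  moreover have "\<forall>\<^sub>F u in at_right (l - t). u \<in> {l - t<..<l}"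
    using t by (intro eventually_at_rightI) auto
  ultimately show "\<forall>\<^sub>F u in at_right (l - t). g (l - (l - t)) - g (l - u) =
      of_int (- (k + (\<Sum>s\<in>{s\<in>S. s < t}. c s))) * (u - (l - t))"
  proof eventually_elim
    case (elim u)
    then have "{s \<in> S. s \<le> l - u} = {s \<in> S. s < t}"
      by auto
    with elim t show ?case
      using broken_line_diff[OF S, of "l - u" t a k c] by (simp add: g algebra_simps)
  qed
qed

text \<open>
  Passing \<open>t\<close> changes the accumulated slope by the summand of \<open>t\<close> alone.
\<close>

lemma bend_broken_line:
  assumes S: "finite S" and t: "0 < t" "t < l"
    and g: "\<And>t. t \<in> {0..l} \<Longrightarrow> g t = broken_line a k S c t"
  shows "bend l g t = (if t \<in> S then c t else 0)"
proof -
  have "{s\<in>S. s \<le> t} = {s\<in>S. s < t} \<union> (if t \<in> S then {t} else {})"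
    by (auto simp: less_le)
  then have "(\<Sum>s\<in>{s\<in>S. s \<le> t}. c s) = (\<Sum>s\<in>{s\<in>S. s < t}. c s) + (if t \<in> S then c t else 0)"
    using S by (auto simp: sum.union_disjoint)
  then show ?thesis
    using t in_slope_broken_line[OF S _ t(2) g] in_slope_reverse_broken_line[OF S t(1) _ g]
    by (simp add: bend_def)
qed

section \<open>Piecewise affine functions are broken lines\<close>

text \<open>
  A new breakpoint to the right of all others leaves the function unchanged up to that point and
  changes its slope \<open>m\<close> from there on. This is the step that appends one affine piece.
\<close>

lemma broken_line_add_break:
  assumes S: "finite S" "S \<subseteq> {..<p}"
    and m: "m = - (k + sum c S)"
  shows "t \<le> p \<Longrightarrow> broken_line a k (insert p S) (c(p := d)) t = broken_line a k S c t"
    and "p \<le> t \<Longrightarrow> broken_line a k (insert p S) (c(p := d)) t =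
      broken_line a k S c p + of_int (m - d) * (t - p)"
proof -
  have p: "p \<notin> S" using S by auto
  have *: "broken_line a k (insert p S) (c(p := d)) t =
      broken_line a k S c t - of_int d * max 0 (t - p)" for t
  proof -
    have "(\<Sum>s\<in>S. of_int ((c(p := d)) s) * max 0 (t - s)) = (\<Sum>s\<in>S. of_int (c s) * max 0 (t - s))"
      using p by (intro sum.cong) auto
    then show ?thesis
      using S p by (simp add: broken_line_def del: fun_upd_apply) simp
  qed
  then show "t \<le> p \<Longrightarrow> broken_line a k (insert p S) (c(p := d)) t = broken_line a k S c t"
    by simp
  assume t: "p \<le> t"
  have "{s \<in> S. s \<le> p} = S"
    using S by auto
  with t S have "broken_line a k S c p - broken_line a k S c t = of_int (- m) * (t - p)"
    using broken_line_diff[of S p t a k c] by (force simp: m)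
  with t show "broken_line a k (insert p S) (c(p := d)) t =
      broken_line a k S c p + of_int (m - d) * (t - p)"
    unfolding * by (simp add: algebra_simps)
qed

lemma piecewise_integral_affine_imp_broken_line:
  assumes g: "piecewise_integral_affine l g" and l: "0 < l"
  shows "\<exists>k S c. finite S \<and> S \<subseteq> {0<..<l} \<and> (\<forall>t\<in>{0..l}. g t = broken_line (g 0) k S c t)"
proof -
  obtain n :: nat and s :: "nat \<Rightarrow> real" where s: "s 0 = 0" "s n = l"
    and step: "\<And>i. i < n \<Longrightarrow> s i < s (Suc i)"
    and aff: "\<And>i. i < n \<Longrightarrow> \<exists>k::int. \<forall>t\<in>{s i..s (Suc i)}. g t = g (s i) + of_int k * (t - s i)"
    using g unfolding piecewise_integral_affine_def by blast
  have claim: "\<exists>k S c. finite S \<and> S \<subseteq> {0<..<s (Suc j)} \<and>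
      (\<forall>t\<in>{0..s (Suc j)}. g t = broken_line (g 0) k S c t)" if "j < n" for j
    using that
  proof (induction j)
    case 0
    with aff[of 0] s obtain m :: int where "\<forall>t\<in>{0..s (Suc 0)}. g t = g 0 + of_int m * t"
      by auto
    moreover have "broken_line (g 0) (- m) {} (\<lambda>_. 0) t = g 0 + of_int m * t" for t
      by (simp add: broken_line_def)
    ultimately show ?case
      by (intro exI[of _ "- m"] exI[of _ "{}"] exI[of _ "\<lambda>_. 0"]) (simp only: finite.emptyI empty_subsetI simp_thms)
  next
    case (Suc j)
    define p where "p = s (Suc j)"
    obtain k S c where S: "finite S" "S \<subseteq> {0<..<p}"
      and eq: "\<And>t. t \<in> {0..p} \<Longrightarrow> g t = broken_line (g 0) k S c t"
      using Suc unfolding p_def by (meson Suc_lessD)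
    obtain m :: int where m: "\<And>t. t \<in> {p..s (Suc (Suc j))} \<Longrightarrow> g t = g p + of_int m * (t - p)"
      using aff[OF Suc.prems] unfolding p_def by blast
    have nonneg: "0 \<le> s i" if "i \<le> n" for i
      using that by (induction i) (use s step in \<open>auto simp: Suc_le_eq intro: order.trans less_imp_le\<close>)
    have "0 \<le> s j"
      using Suc.prems by (intro nonneg) simp
    then have p: "0 < p" "p < s (Suc (Suc j))"
      using Suc.prems step[of j] step[of "Suc j"] unfolding p_def by simp_all
    have S': "S \<subseteq> {..<p}"
      using S by auto
    \<comment> \<open>The slope of the broken line before \<open>p\<close> is \<open>- (k + sum c S)\<close>; it has to become \<open>m\<close>.\<close>
    let ?c = "c(p := - (k + sum c S) - m)"
    have "g t = broken_line (g 0) k (insert p S) ?c t" if "t \<in> {0..s (Suc (Suc j))}" for t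
    proof (cases "t \<le> p")
      case True
      then show ?thesis
        using that eq[of t] broken_line_add_break(1)[OF S(1) S' refl True] by simp
    next
      case False
      then show ?thesis
        using that m[of t] eq[of p] p broken_line_add_break(2)[OF S(1) S' refl, of t] by simp
    qed
    moreover have "finite (insert p S)" "insert p S \<subseteq> {0<..<s (Suc (Suc j))}"
      using S p by auto
    ultimately show ?case
      by blast
  qed
  obtain j where j: "n = Suc j"
    using s l by (cases n) auto
  with s have "s (Suc j) = l"
    by simp
  from claim[of j, unfolded this] show ?thesis
    by (simp only: j lessI)
qed

text \<open>
  The parameters of a broken line are recovered as the slope at \<open>0\<close> and the bends, so the
  representation is canonical. The freedom in \<open>S\<close> makes it possible to sum bends and a divisor over the
  same set.
\<close>

lemma piecewise_integral_affine_broken_line: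
  assumes g: "piecewise_integral_affine l g" and l: "0 < l"
  shows "finite {t \<in> {0<..<l}. bend l g t \<noteq> 0}"
    and "\<lbrakk>finite S; S \<subseteq> {0<..<l}; {t \<in> {0<..<l}. bend l g t \<noteq> 0} \<subseteq> S; t \<in> {0..l}\<rbrakk> \<Longrightarrow>
      g t = broken_line (g 0) (in_slope g 0) S (bend l g) t"
proof -
  obtain R k c where R: "finite R" "R \<subseteq> {0<..<l}"
    and eq: "\<And>t. t \<in> {0..l} \<Longrightarrow> g t = broken_line (g 0) k R c t"
    using piecewise_integral_affine_imp_broken_line[OF g l] by blast
  have bend: "bend l g t = (if t \<in> R then c t else 0)" if "t \<in> {0<..<l}" for t
    using bend_broken_line[OF R(1) _ _ eq, of t] that by simp
  then have "{t \<in> {0<..<l}. bend l g t \<noteq> 0} \<subseteq> R"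
    by (auto split: if_splits)
  with R show "finite {t \<in> {0<..<l}. bend l g t \<noteq> 0}"
    using finite_subset by blast
  have none: "{s \<in> R. s \<le> 0} = {}"
    using R by auto
  have k: "in_slope g 0 = k"
    using in_slope_broken_line[OF R(1) order.refl l eq] unfolding none by simp
  assume S: "finite S" "S \<subseteq> {0<..<l}" "{t \<in> {0<..<l}. bend l g t \<noteq> 0} \<subseteq> S" and t: "t \<in> {0..l}"
  have "g t = broken_line (g 0) k R c t"
    using eq t .
  also have "\<dots> = broken_line (g 0) k R (bend l g) t"
    using R bend by (intro broken_line_cong) auto
  also have "\<dots> = broken_line (g 0) k (R \<union> S) (bend l g) t"
    using R S bend by (intro broken_line_mono_neutral[symmetric]) auto
  also have "\<dots> = broken_line (g 0) k S (bend l g) t"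
    by (rule broken_line_mono_neutral) (use R S in blast)+
  finally show "g t = broken_line (g 0) (in_slope g 0) S (bend l g) t"
    by (simp add: k)
qed

lemma piecewise_integral_affine_continuous_on:
  assumes "piecewise_integral_affine l g" "0 < l"
  shows "continuous_on {0..l} g"
proof -
  obtain k S c where "\<And>t. t \<in> {0..l} \<Longrightarrow> g t = broken_line (g 0) k S c t"
    using piecewise_integral_affine_imp_broken_line[OF assms] by blast
  then have "continuous_on {0..l} g \<longleftrightarrow> continuous_on {0..l} (broken_line (g 0) k S c)"
    by (intro continuous_on_cong refl)
  then show ?thesis
    by (simp only: continuous_on_broken_line)
qed

text \<open>
  The breakpoints in the interior of the interval, sorted and completed by the two ends, form a
  suitable subdivision.
\<close>

lemma broken_line_piecewise_integral_affine:
  assumes S: "finite S" and l: "0 < l"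
  shows "piecewise_integral_affine l (broken_line a k S c)"
proof -
  define B where "B = insert 0 (insert l (S \<inter> {0<..<l}))"
  define xs where "xs = sorted_list_of_set B"
  have B: "finite B" "0 \<in> B" "l \<in> B" "B \<subseteq> {0..l}"
    using S l by (auto simp: B_def)
  have xs: "sorted_wrt (<) xs" "set xs = B"
    using B by (simp_all add: xs_def)
  have ne: "xs \<noteq> []"
    using xs B by auto
  have less: "xs ! i < xs ! j" if "i < j" "j < length xs" for i j
    using xs(1) that by (simp add: sorted_wrt_nth_less)
  have le: "xs ! i \<le> xs ! j" if "i \<le> j" "j < length xs" for i j
    using less[of i j] that by (cases "i = j") auto
  show ?thesis
    unfolding piecewise_integral_affine_def
  proof (intro exI[of _ "length xs - 1"] exI[of _ "\<lambda>i. xs ! i"] conjI allI impI)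
    \<comment> \<open>The list starts with \<open>0\<close> and ends with \<open>l\<close> because these are the extreme elements of \<open>B\<close>.\<close>
    obtain i where "i < length xs" "xs ! i = 0"
      using xs B by (metis in_set_conv_nth)
    moreover have "xs ! 0 \<in> B"
      using ne xs nth_mem by blast
    ultimately show "xs ! 0 = 0"
      using le[of 0 i] B by fastforce
    obtain i where "i < length xs" "xs ! i = l"
      using xs B by (metis in_set_conv_nth)
    moreover have "xs ! (length xs - 1) \<in> B"
      using ne xs nth_mem[of "length xs - 1" xs] by simp
    ultimately show "xs ! (length xs - 1) = l"
      using le[of i "length xs - 1"] B by fastforce
    fix i assume i: "i < length xs - 1"
    then show "xs ! i < xs ! Suc i"
      by (intro less) auto
    have gap: "s \<le> xs ! i \<or> xs ! Suc i \<le> s" if "s \<in> S" for s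
    proof (cases "s \<in> B")
      case True
      then obtain j where "j < length xs" "xs ! j = s"
        using xs by (metis in_set_conv_nth)
      then show ?thesis
        using le[of j i] le[of "Suc i" j] i by (cases "j \<le> i") auto
    next
      case False
      then have "s \<le> 0 \<or> l \<le> s"
        using that by (auto simp: B_def)
      moreover have "xs ! i \<in> B" "xs ! Suc i \<in> B"
        using i xs nth_mem[of i xs] nth_mem[of "Suc i" xs] by auto
      ultimately show ?thesis
        using B by fastforce
    qed
    show "\<exists>m::int. \<forall>t\<in>{xs ! i..xs ! Suc i}.
        broken_line a k S c t = broken_line a k S c (xs ! i) + of_int m * (t - xs ! i)"
    proof (intro exI ballI)
      fix t assume t: "t \<in> {xs ! i..xs ! Suc i}"
      have "broken_line a k S c (xs ! i) - broken_line a k S c t =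
          of_int (k + (\<Sum>s\<in>{s \<in> S. s \<le> xs ! i}. c s)) * (t - xs ! i)"
        using t gap by (intro broken_line_diff S) (auto intro: order.trans)
      then show "broken_line a k S c t = broken_line a k S c (xs ! i) +
          of_int (- (k + (\<Sum>s\<in>{s \<in> S. s \<le> xs ! i}. c s))) * (t - xs ! i)"
        by (simp add: algebra_simps)
    qed
  qed
qed

lemma piecewise_integral_affine_cong:
  assumes "\<And>t. t \<in> {0..l} \<Longrightarrow> g t = g' t" "piecewise_integral_affine l g"
  shows "piecewise_integral_affine l g'"
proof -
  obtain n :: nat and s :: "nat \<Rightarrow> real" where s: "s 0 = 0" "s n = l"
    and step: "\<And>i. i < n \<Longrightarrow> s i < s (Suc i)"
    and aff: "\<And>i. i < n \<Longrightarrow> \<exists>k::int. \<forall>t\<in>{s i..s (Suc i)}. g t = g (s i) + of_int k * (t - s i)"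
    using assms(2) unfolding piecewise_integral_affine_def by blast
  have mono: "s i \<le> s j" if "i \<le> j" "j \<le> n" for i j
    using that by (induction j) (use step in \<open>auto simp: Suc_le_eq le_Suc_eq intro: order.trans less_imp_le\<close>)
  have "\<exists>k::int. \<forall>t\<in>{s i..s (Suc i)}. g' t = g' (s i) + of_int k * (t - s i)" if "i < n" for i
  proof -
    have "{s i..s (Suc i)} \<subseteq> {0..l}"
      using mono[of 0 i] mono[of "Suc i" n] that s by auto
    moreover have "s i \<in> {s i..s (Suc i)}"
      using step[OF that] by simp
    ultimately show ?thesis
      using aff[OF that] assms(1) by (metis subsetD)
  qed
  with s step show ?thesis
    unfolding piecewise_integral_affine_def by blast
qed

lemma piecewise_integral_affine_reverse:
  assumes "piecewise_integral_affine l g"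
  shows "piecewise_integral_affine l (\<lambda>t. g (l - t))"
proof -
  obtain n :: nat and s :: "nat \<Rightarrow> real" where s: "s 0 = 0" "s n = l"
    and step: "\<And>i. i < n \<Longrightarrow> s i < s (Suc i)"
    and aff: "\<And>i. i < n \<Longrightarrow> \<exists>k::int. \<forall>t\<in>{s i..s (Suc i)}. g t = g (s i) + of_int k * (t - s i)"
    using assms unfolding piecewise_integral_affine_def by blast
  show ?thesis
    unfolding piecewise_integral_affine_def
  proof (intro exI[of _ n] exI[of _ "\<lambda>i. l - s (n - i)"] conjI allI impI)
    fix i assume i: "i < n"
    define j where "j = n - Suc i"
    have j: "j < n" "n - i = Suc j"
      using i by (auto simp: j_def)
    show "l - s (n - i) < l - s (n - Suc i)"
      using step[OF j(1)] j by (simp add: j_def)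
    obtain k :: int where k: "\<forall>t\<in>{s j..s (Suc j)}. g t = g (s j) + of_int k * (t - s j)"
      using aff[OF j(1)] by blast
    show "\<exists>k::int. \<forall>t\<in>{l - s (n - i)..l - s (n - Suc i)}.
        g (l - t) = g (l - (l - s (n - i))) + of_int k * (t - (l - s (n - i)))"
    proof (intro exI[of _ "- k"] ballI)
      fix t assume "t \<in> {l - s (n - i)..l - s (n - Suc i)}"
      then have "l - t \<in> {s j..s (Suc j)}"
        using j by (auto simp: j_def)
      with k have "g (l - t) = g (s j) + of_int k * (l - t - s j)"
        by (rule bspec)
      moreover have "g (s (Suc j)) = g (s j) + of_int k * (s (Suc j) - s j)"
        using step[OF j(1)] by (intro bspec[OF k]) auto
      ultimately show "g (l - t) = g (l - (l - s (n - i))) + of_int (- k) * (t - (l - s (n - i)))"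
        by (simp add: j algebra_simps)
    qed
  qed (use s in auto)
qed

section \<open>Admissibility on one edge\<close>

definition edge_admissible :: "real \<Rightarrow> (real \<Rightarrow> int) \<Rightarrow> bool" where
  "edge_admissible l A \<longleftrightarrow> (\<forall>t\<in>{0<..<l}. A t = 0) \<or>
     (\<exists>s\<in>{0<..<l}. A s = 1 \<and> (\<forall>t\<in>{0<..<l} - {s}. A t = 0))"

lemma edge_admissible_reverse:
  assumes "edge_admissible l A"
  shows "edge_admissible l (\<lambda>t. A (l - t))"
  using assms unfolding edge_admissible_def
proof
  assume "\<forall>t\<in>{0<..<l}. A t = 0"
  then show "(\<forall>t\<in>{0<..<l}. A (l - t) = 0) \<or>
      (\<exists>s\<in>{0<..<l}. A (l - s) = 1 \<and> (\<forall>t\<in>{0<..<l} - {s}. A (l - t) = 0))"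
    by simp
next
  assume "\<exists>s\<in>{0<..<l}. A s = 1 \<and> (\<forall>t\<in>{0<..<l} - {s}. A t = 0)"
  then obtain s where s: "s \<in> {0<..<l}" "A s = 1" "\<And>t. t \<in> {0<..<l} - {s} \<Longrightarrow> A t = 0"
    by blast
  have "A (l - t) = 0" if "t \<in> {0<..<l} - {l - s}" for t
    using that by (intro s(3)) auto
  with s(1,2) have "\<exists>s\<in>{0<..<l}. A (l - s) = 1 \<and> (\<forall>t\<in>{0<..<l} - {s}. A (l - t) = 0)"
    by (intro bexI[of _ "l - s"]) auto
  then show "(\<forall>t\<in>{0<..<l}. A (l - t) = 0) \<or>
      (\<exists>s\<in>{0<..<l}. A (l - s) = 1 \<and> (\<forall>t\<in>{0<..<l} - {s}. A (l - t) = 0))" ..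
qed

text \<open>
  The dividend \<open>f(t) - f(h) + \<tau>\<close> of the Euclidean division, for boundary values \<open>a\<close> at the
  tail and \<open>b\<close> at the head.
\<close>

definition twisted_drop :: "real \<Rightarrow> (real \<Rightarrow> int) \<Rightarrow> real \<Rightarrow> real \<Rightarrow> real" where
  "twisted_drop l D a b = a - b + (\<Sum>t\<in>{t\<in>{0<..<l}. D t \<noteq> 0}. (l - t) * of_int (D t))"

lemma twisted_drop_superset:
  assumes "finite S" "S \<subseteq> {0<..<l}" "{t\<in>{0<..<l}. D t \<noteq> 0} \<subseteq> S"
  shows "twisted_drop l D a b = a - b + (\<Sum>t\<in>S. (l - t) * of_int (D t))"
proof -
  have "(\<Sum>t\<in>{t\<in>{0<..<l}. D t \<noteq> 0}. (l - t) * of_int (D t)) = (\<Sum>t\<in>S. (l - t) * of_int (D t))"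
    using assms by (intro sum.mono_neutral_left) auto
  then show ?thesis
    by (simp add: twisted_drop_def)
qed

lemma broken_line_end:
  assumes "S \<subseteq> {0<..<l}"
  shows "broken_line a k S c l = a - of_int k * l - (\<Sum>t\<in>S. (l - t) * of_int (c t))"
proof -
  have "(\<Sum>s\<in>S. of_int (c s) * max 0 (l - s)) = (\<Sum>t\<in>S. (l - t) * of_int (c t))"
    using assms by (intro sum.cong) (auto simp: max_def)
  then show ?thesis
    by (simp add: broken_line_def)
qed

text \<open>
  The broken line representation at the end point \<open>l\<close>. The weights \<open>l - t\<close> of the twister are
  exactly the weights with which the bends enter the value at \<open>l\<close>, which is why the divisor and the bends
  combine into \<open>D + bend\<close>.
\<close>

lemma twisted_drop_eq:
  assumes g: "piecewise_integral_affine l g" and l: "0 < l"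
    and S: "finite S" "S \<subseteq> {0<..<l}" "{t\<in>{0<..<l}. D t \<noteq> 0 \<or> bend l g t \<noteq> 0} \<subseteq> S"
  shows "twisted_drop l D (g 0) (g l) =
    of_int (in_slope g 0) * l + (\<Sum>t\<in>S. (l - t) * of_int (D t + bend l g t))"
proof -
  have "{t \<in> {0<..<l}. bend l g t \<noteq> 0} \<subseteq> S" "{t \<in> {0<..<l}. D t \<noteq> 0} \<subseteq> S"
    using S(3) by auto
  moreover have "l \<in> {0..l}"
    using l by simp
  ultimately have "g l = broken_line (g 0) (in_slope g 0) S (bend l g) l"
    "twisted_drop l D (g 0) (g l) = g 0 - g l + (\<Sum>t\<in>S. (l - t) * of_int (D t))"
    using piecewise_integral_affine_broken_line(2)[OF g l S(1,2)] twisted_drop_superset[OF S(1,2)]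
    by blast+
  then show ?thesis
    unfolding broken_line_end[OF S(2)] by (simp add: distrib_left sum.distrib)
qed

text \<open>
  Admissibility turns \<open>twisted_drop_eq\<close> into a division with remainder: the sum has at most one nonzero
  summand, which is \<open>l - s\<close> and lies strictly between \<open>0\<close> and \<open>l\<close>.
\<close>

lemma edge_admissible_imp:
  assumes g: "piecewise_integral_affine l g" and l: "0 < l"
    and D: "finite {t\<in>{0<..<l}. D t \<noteq> 0}"
    and adm: "edge_admissible l (\<lambda>t. D t + bend l g t)"
  shows "in_slope g 0 = \<lfloor>twisted_drop l D (g 0) (g l) / l\<rfloor> \<and>
    (\<forall>t\<in>{0<..<l}. D t + bend l g t =
      (if l - t = twisted_drop l D (g 0) (g l) rmod l then 1 else 0))"
proof -
  define Y where "Y = twisted_drop l D (g 0) (g l)"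
  define S where "S = {t\<in>{0<..<l}. D t \<noteq> 0} \<union> {t\<in>{0<..<l}. bend l g t \<noteq> 0}"
  have S: "finite S" "S \<subseteq> {0<..<l}"
    using D piecewise_integral_affine_broken_line(1)[OF g l] by (auto simp: S_def)
  have Y_eq: "Y = of_int (in_slope g 0) * l + (\<Sum>t\<in>S'. (l - t) * of_int (D t + bend l g t))"
    if "finite S'" "S' \<subseteq> {0<..<l}" "S \<subseteq> S'" for S'
    unfolding Y_def using that by (intro twisted_drop_eq g l) (auto simp: S_def)
  from adm consider (zero) "\<And>t. t \<in> {0<..<l} \<Longrightarrow> D t + bend l g t = 0"
    | (one) s where "s \<in> {0<..<l}" "D s + bend l g s = 1"
      "\<And>t. t \<in> {0<..<l} - {s} \<Longrightarrow> D t + bend l g t = 0"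
    unfolding edge_admissible_def by blast
  then show ?thesis
    unfolding Y_def[symmetric]
  proof cases
    case zero
    then have "(\<Sum>t\<in>S. (l - t) * of_int (D t + bend l g t)) = 0"
      using S by (intro sum.neutral) (metis mult_zero_right of_int_0 subsetD)
    then have Y: "Y = of_int (in_slope g 0) * l"
      using Y_eq[OF S order.refl] by simp
    show "in_slope g 0 = \<lfloor>Y / l\<rfloor> \<and>
        (\<forall>t\<in>{0<..<l}. D t + bend l g t = (if l - t = Y rmod l then 1 else 0))"
      unfolding Y using zero l by simp
  next
    case one
    \<comment> \<open>Since \<open>D s + bend l g s = 1\<close>, the point \<open>s\<close> is in \<open>S\<close>; inserting it spares the argument.\<close>
    have "(\<Sum>t\<in>insert s S. (l - t) * of_int (D t + bend l g t)) =
        (\<Sum>t\<in>insert s S. if t = s then l - s else 0)"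
    proof (rule sum.cong)
      fix t assume "t \<in> insert s S"
      then have "t = s \<or> t \<in> {0<..<l} - {s}"
        using S by auto
      then show "(l - t) * of_int (D t + bend l g t) = (if t = s then l - s else 0)"
        using one(2) one(3)[of t] by auto
    qed simp
    also have "\<dots> = l - s"
      using S by simp
    finally have Y: "Y = of_int (in_slope g 0) * l + (l - s)"
      using Y_eq[of "insert s S"] S one(1) by auto
    have "Y rmod l = l - s"
      using one(1) by (intro rmod_unique[where n = "in_slope g 0"]) (auto simp: Y)
    moreover have "\<lfloor>Y / l\<rfloor> = in_slope g 0"
      using one(1) by (intro floor_unique) (auto simp: Y field_simps)
    ultimately show "in_slope g 0 = \<lfloor>Y / l\<rfloor> \<and>
        (\<forall>t\<in>{0<..<l}. D t + bend l g t = (if l - t = Y rmod l then 1 else 0))"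
      using one(2,3) by auto
  qed
qed

lemma edge_admissible_remainder:
  assumes l: "0 < l"
    and A: "\<And>t. t \<in> {0<..<l} \<Longrightarrow> A t = (if l - t = y rmod l then 1 else 0)"
  shows "edge_admissible l A"
proof (cases "y rmod l = 0")
  case True
  then show ?thesis
    using A by (auto simp: edge_admissible_def)
next
  case False
  then have r: "l - y rmod l \<in> {0<..<l}"
    using rmod_nonneg[of l y] rmod_less[of l y] l by auto
  then show ?thesis
    using A unfolding edge_admissible_def by (intro disjI2 bexI[of _ "l - y rmod l"]) auto
qed

text \<open>
  With equal bends, the two broken lines differ by a linear function, which vanishes because
  it does so at the end point \<open>l\<close>.
\<close>

lemma edge_unique:
  assumes g: "piecewise_integral_affine l g" and g': "piecewise_integral_affine l g'" and l: "0 < l"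
    and ends: "g 0 = g' 0" "g l = g' l"
    and bends: "\<And>t. t \<in> {0<..<l} \<Longrightarrow> bend l g t = bend l g' t"
    and t: "t \<in> {0..l}"
  shows "g t = g' t"
proof -
  define S where "S = {t \<in> {0<..<l}. bend l g t \<noteq> 0}"
  have S: "finite S" "S \<subseteq> {0<..<l}" "{t \<in> {0<..<l}. bend l g' t \<noteq> 0} \<subseteq> S"
    using piecewise_integral_affine_broken_line(1)[OF g l] bends by (auto simp: S_def)
  have g_eq: "g t = broken_line (g 0) (in_slope g 0) S (bend l g) t" if "t \<in> {0..l}" for t
    using that S by (intro piecewise_integral_affine_broken_line(2)[OF g l]) (auto simp: S_def)
  have g'_eq: "g' t = broken_line (g 0) (in_slope g' 0) S (bend l g) t" if "t \<in> {0..l}" for t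
  proof -
    have "g' t = broken_line (g' 0) (in_slope g' 0) S (bend l g') t"
      using that S by (intro piecewise_integral_affine_broken_line(2)[OF g' l])
    also have "\<dots> = broken_line (g 0) (in_slope g' 0) S (bend l g) t"
      unfolding ends using S bends by (intro broken_line_cong) auto
    finally show ?thesis .
  qed
  have "in_slope g 0 = in_slope g' 0"
    using g_eq[of l] g'_eq[of l] l ends unfolding broken_line_end[OF S(2)] by simp
  with g_eq[OF t] g'_eq[OF t] show ?thesis
    by simp
qed

text \<open>
  The quotient of the division serves as slope, and the bends are chosen to make \<open>D + bend\<close> equal to the
  indicator of \<open>l - r\<close>, where \<open>r\<close> is the remainder. The value at \<open>l\<close> is then \<open>b\<close> because
  quotient and remainder recover the dividend.
\<close>

lemma edge_exists:
  assumes l: "0 < l" and D: "finite {t\<in>{0<..<l}. D t \<noteq> 0}"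
  shows "\<exists>g. piecewise_integral_affine l g \<and> g 0 = a \<and> g l = b \<and>
    edge_admissible l (\<lambda>t. D t + bend l g t)"
proof -
  define Y where "Y = twisted_drop l D a b"
  define r where "r = Y rmod l"
  \<comment> \<open>For \<open>r = 0\<close> the point \<open>l - r\<close> is the end of the edge and does not count as a breakpoint.\<close>
  define S where "S = {t\<in>{0<..<l}. D t \<noteq> 0} \<union> {l - r} \<inter> {0<..<l}"
  define c where "c t = (if l - t = r then 1 else 0) - D t" for t
  define g where "g = broken_line a \<lfloor>Y / l\<rfloor> S c"
  have S: "finite S" "S \<subseteq> {0<..<l}"
    using D by (auto simp: S_def)
  have r: "0 \<le> r" "r < l" "Y = l * of_int \<lfloor>Y / l\<rfloor> + r"
    using l rmod_nonneg[of l Y] rmod_less[of l Y] by (auto simp: r_def rmod_def)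
  have "g 0 = a"
    using S(2) by (auto simp: g_def broken_line_def intro!: sum.neutral)
  moreover have "g l = b"
  proof -
    have "(\<Sum>t\<in>S. (l - t) * of_int (if l - t = r then 1 else 0)) = (\<Sum>t\<in>S. if t = l - r then r else 0)"
      by (intro sum.cong) auto
    also have "\<dots> = r"
      using S(1) r(1,2) by (auto simp: S_def)
    finally have "(\<Sum>t\<in>S. (l - t) * of_int (if l - t = r then 1 else 0)) = r" .
    moreover have "Y = a - b + (\<Sum>t\<in>S. (l - t) * of_int (D t))"
      unfolding Y_def by (intro twisted_drop_superset S) (auto simp: S_def)
    ultimately have "(\<Sum>t\<in>S. (l - t) * of_int (c t)) = r - (Y - (a - b))"
      by (simp only: c_def of_int_diff right_diff_distrib sum_subtractf)
    then show ?thesis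
      unfolding g_def broken_line_end[OF S(2)] using r(3) by (simp add: mult.commute)
  qed
  moreover have "edge_admissible l (\<lambda>t. D t + bend l g t)"
  proof (rule edge_admissible_remainder[OF l, of _ Y])
    fix t assume t: "t \<in> {0<..<l}"
    then have "bend l g t = (if t \<in> S then c t else 0)"
      by (intro bend_broken_line[OF S(1)]) (auto simp: g_def)
    with t show "D t + bend l g t = (if l - t = Y rmod l then 1 else 0)"
      unfolding r_def[symmetric] by (auto simp: c_def S_def)
  qed
  moreover have "piecewise_integral_affine l g"
    unfolding g_def using S(1) l by (rule broken_line_piecewise_integral_affine)
  ultimately show ?thesis
    by blast
qed

section \<open>Points, divisors and functions on a metric graph\<close>

locale metric_graph = fin_digraph G + bidirected_digraph G arev
  for G :: "('a, 'b) pre_digraph" and arev :: "'b \<Rightarrow> 'b" +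
  fixes len :: "'b \<Rightarrow> real"
  assumes len_pos: "e \<in> arcs G \<Longrightarrow> 0 < len e"
    and len_arev: "e \<in> arcs G \<Longrightarrow> len (arev e) = len e"
begin

abbreviation point :: "'b \<Rightarrow> real \<Rightarrow> ('a, 'b) mpoint" where
  "point \<equiv> pt G arev len"

abbreviation (input) on_edge :: "(('a, 'b) mpoint \<Rightarrow> 'c) \<Rightarrow> 'b \<Rightarrow> real \<Rightarrow> 'c" where
  "on_edge h e t \<equiv> h (point e t)"

lemma point_0 [simp]: "point e 0 = Vertex (tail G e)"
  by (simp add: pt_def)

lemma point_len: "e \<in> arcs G \<Longrightarrow> point e (len e) = Vertex (head G e)"
  using len_pos[of e] by (simp add: pt_def)

lemma point_inner:
  "t \<in> {0<..<len e} \<Longrightarrow> point e t = Inner {(e, t), (arev e, len e - t)}"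
  by (simp add: pt_def)

lemma point_arev: "e \<in> arcs G \<Longrightarrow> point (arev e) (len e - t) = point e t"
  using len_pos[of e] by (auto simp: pt_def len_arev)

lemma point_in_mpoints: "e \<in> arcs G \<Longrightarrow> t \<in> {0..len e} \<Longrightarrow> point e t \<in> mpoints G arev len"
  unfolding mpoints_def by blast

lemma mpoints_cases:
  assumes "x \<in> mpoints G arev len"
  obtains v where "v \<in> verts G" "x = Vertex v"
    | e t where "e \<in> arcs G" "t \<in> {0<..<len e}" "x = point e t"
proof -
  from assms consider v where "v \<in> verts G" "x = Vertex v"
    | e t where "e \<in> arcs G" "t \<in> {0..len e}" "x = point e t"
    by (auto simp: mpoints_def)
  then show thesis
  proof cases
    case (2 e t)
    then consider "t = 0" | "t = len e" | "t \<in> {0<..<len e}"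
      by force
    then show thesis
      by cases (use 2 that(1)[of "tail G e"] that(1)[of "head G e"] that(2)[of e t] point_len[of e]
        in auto)
  qed (use that in blast)
qed

lemma inj_on_point: "e \<in> arcs G \<Longrightarrow> inj_on (point e) {0<..<len e}"
  using arev_neq by (auto simp: inj_on_def point_inner doubleton_eq_iff)

lemma tangent_directions_inner:
  assumes e: "e \<in> arcs G" and t: "t \<in> {0<..<len e}"
  shows "tangent_directions G arev len (point e t) = {(e, t), (arev e, len e - t)}"
proof
  show "{(e, t), (arev e, len e - t)} \<subseteq> tangent_directions G arev len (point e t)"
    using e t point_arev[OF e, of t] by (auto simp: tangent_directions_def len_arev)
  show "tangent_directions G arev len (point e t) \<subseteq> {(e, t), (arev e, len e - t)}"
  proof
    fix p assume "p \<in> tangent_directions G arev len (point e t)"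
    then obtain e' t' where p: "p = (e', t')" "0 \<le> t'" "t' < len e'" "point e' t' = point e t"
      by (auto simp: tangent_directions_def)
    then have "Inner {(e', t'), (arev e', len e' - t')} = point e t"
      using point_inner[OF t] by (auto simp: pt_def split: if_splits)
    then have "{(e', t'), (arev e', len e' - t')} = {(e, t), (arev e, len e - t)}"
      using point_inner[OF t] by simp
    moreover have "p \<in> {(e', t'), (arev e', len e' - t')}"
      by (simp add: p(1))
    ultimately show "p \<in> {(e, t), (arev e, len e - t)}"
      by simp
  qed
qed

text \<open>
  An interior point has one tangent direction for each orientation of its edge. Read along \<open>e\<close>, the one of
  \<open>arev e\<close> is the direction of the reversed interval, so the two incoming slopes add up to the bend.
\<close>

lemma divisor_of_inner:
  assumes e: "e \<in> arcs G" and t: "t \<in> {0<..<len e}"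
  shows "divisor_of G arev len h (point e t) = bend (len e) (on_edge h e) t"
proof -
  have "on_edge h (arev e) s = on_edge h e (len e - s)" for s
    using point_arev[OF e, of "len e - s"] by simp
  moreover have "e \<noteq> arev e"
    using arev_neq[OF e] by simp
  ultimately show ?thesis
    by (simp add: divisor_of_def ord_at_def tangent_directions_inner[OF e t] bend_def
        incoming_slope_def in_slope_def)
qed

lemma divisor_of_outside:
  assumes "x \<notin> mpoints G arev len"
  shows "divisor_of G arev len h x = 0"
proof -
  have "tangent_directions G arev len x = {}"
    using assms by (auto simp: tangent_directions_def intro: point_in_mpoints)
  then show ?thesis
    by (simp add: divisor_of_def ord_at_def)
qed

lemma incoming_slope_tail: "incoming_slope G arev len h e 0 = in_slope (on_edge h e) 0"
  by (simp add: incoming_slope_def in_slope_def)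

lemma mdivisor_on_edge_finite:
  assumes "mdivisor G arev len D" "e \<in> arcs G"
  shows "finite {t \<in> {0<..<len e}. on_edge D e t \<noteq> 0}"
proof -
  have "point e ` {t \<in> {0<..<len e}. on_edge D e t \<noteq> 0} \<subseteq> {x. D x \<noteq> 0}"
    by auto
  with assms have "finite (point e ` {t \<in> {0<..<len e}. on_edge D e t \<noteq> 0})"
    unfolding mdivisor_def using finite_subset by blast
  then show ?thesis
    by (rule finite_imageD) (rule inj_on_subset[OF inj_on_point[OF assms(2)]], auto)
qed

text \<open>
  A nonzero order can only occur at the finitely many vertices and at the finitely many bends on
  each of the finitely many edges.
\<close>

lemma mdivisor_add_divisor_of:
  assumes D: "mdivisor G arev len D" and h: "h \<in> rational_functions G arev len"
  shows "mdivisor G arev len (\<lambda>x. D x + divisor_of G arev len h x)"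
proof -
  let ?B = "\<lambda>e. {t \<in> {0<..<len e}. bend (len e) (on_edge h e) t \<noteq> 0}"
  have fin: "finite (?B e)" if "e \<in> arcs G" for e
    using h that len_pos
    by (intro piecewise_integral_affine_broken_line(1)) (auto simp: rational_functions_def)
  have "x \<in> {x. D x \<noteq> 0} \<union> Vertex ` verts G \<union> (\<Union>e\<in>arcs G. point e ` ?B e)"
    if x: "D x + divisor_of G arev len h x \<noteq> 0" for x
  proof (cases "D x = 0")
    case True
    with x have nz: "divisor_of G arev len h x \<noteq> 0"
      by simp
    then have "x \<in> mpoints G arev len"
      using divisor_of_outside by blast
    then show ?thesis
    proof (cases rule: mpoints_cases)
      case (2 e t)
      with nz have "t \<in> ?B e"
        by (simp add: divisor_of_inner)
      with 2 show ?thesis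
        by blast
    qed auto
  qed simp
  then have "{x. D x + divisor_of G arev len h x \<noteq> 0} \<subseteq>
      {x. D x \<noteq> 0} \<union> Vertex ` verts G \<union> (\<Union>e\<in>arcs G. point e ` ?B e)"
    by blast
  moreover have "finite ({x. D x \<noteq> 0} \<union> Vertex ` verts G \<union> (\<Union>e\<in>arcs G. point e ` ?B e))"
    using D fin by (auto simp: mdivisor_def)
  ultimately have "finite {x. D x + divisor_of G arev len h x \<noteq> 0}"
    using finite_subset by blast
  moreover have "x \<in> mpoints G arev len" if "D x + divisor_of G arev len h x \<noteq> 0" for x
    using that D divisor_of_outside[of x h] by (cases "D x = 0") (auto simp: mdivisor_def)
  ultimately show ?thesis
    by (auto simp: mdivisor_def)
qed

lemma edge_admissible_on_edge:
  assumes e: "e \<in> arcs G"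
  shows "edge_admissible (len e) (on_edge A e) \<longleftrightarrow>
    (\<forall>x\<in>edge_interior G arev len e. A x = 0) \<or>
    (\<exists>x\<in>edge_interior G arev len e. A x = 1 \<and> (\<forall>y\<in>edge_interior G arev len e - {x}. A y = 0))"
proof -
  have "point e ` {0<..<len e} - {point e s} = point e ` ({0<..<len e} - {s})"
    if "s \<in> {0<..<len e}" for s
    using inj_on_point[OF e] that by (auto dest: inj_onD)
  then show ?thesis
    by (simp add: edge_admissible_def edge_interior_def)
qed

lemma admissible_iff_edge_admissible:
  assumes "mdivisor G arev len D" and h: "h \<in> rational_functions G arev len"
  shows "admissible G arev len (\<lambda>x. D x + divisor_of G arev len h x) \<longleftrightarrow>
    (\<forall>e\<in>arcs G. edge_admissible (len e) (\<lambda>t. on_edge D e t + bend (len e) (on_edge h e) t))"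
proof -
  have "edge_admissible (len e) (\<lambda>t. on_edge D e t + divisor_of G arev len h (point e t)) \<longleftrightarrow>
      edge_admissible (len e) (\<lambda>t. on_edge D e t + bend (len e) (on_edge h e) t)"
    if "e \<in> arcs G" for e
    unfolding edge_admissible_def using that by (simp add: divisor_of_inner)
  then show ?thesis
    using mdivisor_add_divisor_of[OF assms]
      edge_admissible_on_edge[of _ "\<lambda>x. D x + divisor_of G arev len h x"]
    by (simp add: admissible_def)
qed

lemma continuous_map_mtopologyI:
  assumes "\<And>e. e \<in> arcs G \<Longrightarrow> continuous_on {0..len e} (on_edge h e)"
  shows "continuous_map (mtopology G arev len) euclideanreal h"
  unfolding continuous_map_def
proof (intro conjI allI impI)
  fix U :: "real set" assume "openin euclideanreal U"
  then have U: "open U"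
    by simp
  have "openin (top_of_set {0..len e}) {t \<in> {0..len e}. point e t \<in> {x \<in> mpoints G arev len. h x \<in> U}}"
    if e: "e \<in> arcs G" for e
  proof -
    have "{t \<in> {0..len e}. point e t \<in> {x \<in> mpoints G arev len. h x \<in> U}} =
        {0..len e} \<inter> on_edge h e -` U"
      using point_in_mpoints[OF e] by auto
    then show ?thesis
      using continuous_openin_preimage_gen[OF assms[OF e] U] by simp
  qed
  then show "openin (mtopology G arev len) {x \<in> topspace (mtopology G arev len). h x \<in> U}"
    unfolding openin_mtopology by auto
qed simp

text \<open>
  The value at an interior point may be computed in any of its two descriptions, since \<open>F\<close> is
  compatible with reversal; a choice operator picks one.
\<close>

lemma glue_edge_functions:
  assumes ends: "\<And>e. e \<in> arcs G \<Longrightarrow> F e 0 = f (tail G e) \<and> F e (len e) = f (head G e)"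
    and rev: "\<And>e t. e \<in> arcs G \<Longrightarrow> t \<in> {0..len e} \<Longrightarrow> F (arev e) (len e - t) = F e t"
  obtains h where "h \<in> extensional (mpoints G arev len)" "extends G f h"
    "\<And>e t. e \<in> arcs G \<Longrightarrow> t \<in> {0..len e} \<Longrightarrow> on_edge h e t = F e t"
proof
  define h0 where "h0 x = (case x of Vertex v \<Rightarrow> f v | Inner X \<Rightarrow> case_prod F (SOME p. p \<in> X))"
    for x :: "('a, 'b) mpoint"
  let ?h = "restrict h0 (mpoints G arev len)"
  show "?h \<in> extensional (mpoints G arev len)"
    by simp
  show "extends G f ?h"
    by (auto simp: extends_def h0_def mpoints_def)
  fix e t assume e: "e \<in> arcs G" and t: "t \<in> {0..len e}"
  have "h0 (point e t) = F e t"
  proof (cases "t \<in> {0<..<len e}")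
    case True
    define p where "p = (SOME p. p \<in> {(e, t), (arev e, len e - t)})"
    have "p \<in> {(e, t), (arev e, len e - t)}"
      unfolding p_def by (rule someI[of _ "(e, t)"]) simp
    then have "case_prod F p = F e t"
      using rev[OF e t] by auto
    then show ?thesis
      by (simp add: point_inner[OF True] h0_def p_def)
  next
    case False
    with t have "t = 0 \<or> t = len e"
      by auto
    then show ?thesis
      using ends[OF e] point_len[OF e] by (auto simp: h0_def)
  qed
  then show "on_edge ?h e t = F e t"
    using point_in_mpoints[OF e t] by simp
qed

section \<open>Existence and uniqueness of the admissible extension\<close>

definition admissible_extension ::
  "(('a, 'b) mpoint \<Rightarrow> int) \<Rightarrow> ('a \<Rightarrow> real) \<Rightarrow> (('a, 'b) mpoint \<Rightarrow> real) \<Rightarrow> bool" where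
  "admissible_extension D f h \<longleftrightarrow> h \<in> rational_functions G arev len \<and> extends G f h \<and>
     admissible G arev len (\<lambda>x. D x + divisor_of G arev len h x)"

lemma rational_function_on_edge:
  assumes "h \<in> rational_functions G arev len" "extends G f h" and e: "e \<in> arcs G"
  shows "piecewise_integral_affine (len e) (on_edge h e)"
    and "on_edge h e 0 = f (tail G e)" and "on_edge h e (len e) = f (head G e)"
  using assms point_len[OF e] by (auto simp: rational_functions_def extends_def)

lemma twisted_drop_twister:
  "twisted_drop (len e) (on_edge D e) a b = a - b + twister G arev len D e"
  by (simp add: twisted_drop_def twister_def)

lemma admissible_extension_slope_and_divisor:
  assumes D: "mdivisor G arev len D" and h: "admissible_extension D f h" and e: "e \<in> arcs G"
  shows "incoming_slope G arev len h e 0 =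
      \<lfloor>(f (tail G e) - f (head G e) + twister G arev len D e) / len e\<rfloor>"
    and "t \<in> {0<..<len e} \<Longrightarrow> on_edge D e t + divisor_of G arev len h (point e t) =
      (if len e - t = (f (tail G e) - f (head G e) + twister G arev len D e) rmod len e
       then 1 else 0)"
proof -
  have h': "h \<in> rational_functions G arev len" "extends G f h"
    "edge_admissible (len e) (\<lambda>t. on_edge D e t + bend (len e) (on_edge h e) t)"
    using h e admissible_iff_edge_admissible[OF D] by (auto simp: admissible_extension_def)
  note edge = rational_function_on_edge[OF h'(1,2) e]
  note * = edge_admissible_imp[OF edge(1) len_pos[OF e] mdivisor_on_edge_finite[OF D e] h'(3),
      unfolded edge(2,3) twisted_drop_twister]
  show "incoming_slope G arev len h e 0 =
      \<lfloor>(f (tail G e) - f (head G e) + twister G arev len D e) / len e\<rfloor>"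
    using * by (simp add: incoming_slope_tail)
  show "t \<in> {0<..<len e} \<Longrightarrow> on_edge D e t + divisor_of G arev len h (point e t) =
      (if len e - t = (f (tail G e) - f (head G e) + twister G arev len D e) rmod len e
       then 1 else 0)"
    using * e by (simp add: divisor_of_inner)
qed

text \<open>
  The divisor values given by the remainder are admissible whatever the dividend is, because they are the
  indicator of at most one interior point.
\<close>

lemma admissible_extensionI:
  assumes D: "mdivisor G arev len D"
    and h: "h \<in> rational_functions G arev len" "extends G f h"
    and A: "\<And>e t. e \<in> arcs G \<Longrightarrow> t \<in> {0<..<len e} \<Longrightarrow>
      on_edge D e t + divisor_of G arev len h (point e t) =
      (if len e - t = (f (tail G e) - f (head G e) + twister G arev len D e) rmod len e
       then 1 else 0)"
  shows "admissible_extension D f h"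
proof -
  have "edge_admissible (len e) (\<lambda>t. on_edge D e t + bend (len e) (on_edge h e) t)"
    if e: "e \<in> arcs G" for e
    using A[OF e] e len_pos[OF e] by (intro edge_admissible_remainder) (simp_all add: divisor_of_inner)
  with h show ?thesis
    by (simp add: admissible_extension_def admissible_iff_edge_admissible[OF D])
qed

text \<open>
  The values of \<open>D + div(h)\<close> inside an edge are the same for both functions, hence so are their bends, and
  \<open>edge_unique\<close> applies on each edge.
\<close>

lemma admissible_extension_unique:
  assumes D: "mdivisor G arev len D"
    and h: "admissible_extension D f h" and h': "admissible_extension D f h'"
  shows "h = h'"
proof (rule extensionalityI[of _ "mpoints G arev len"])
  have rat: "h \<in> rational_functions G arev len" "extends G f h"
    "h' \<in> rational_functions G arev len" "extends G f h'"
    using h h' by (auto simp: admissible_extension_def)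
  then show "h \<in> extensional (mpoints G arev len)" "h' \<in> extensional (mpoints G arev len)"
    by (auto simp: rational_functions_def)
  fix x assume "x \<in> mpoints G arev len"
  then show "h x = h' x"
  proof (cases rule: mpoints_cases)
    case (1 v)
    with rat show ?thesis
      by (simp add: extends_def)
  next
    case (2 e t)
    note edge = rational_function_on_edge[OF rat(1,2) 2(1)]
    note edge' = rational_function_on_edge[OF rat(3,4) 2(1)]
    have bends: "bend (len e) (on_edge h e) s = bend (len e) (on_edge h' e) s" if "s \<in> {0<..<len e}" for s
      using admissible_extension_slope_and_divisor(2)[OF D h 2(1) that]
        admissible_extension_slope_and_divisor(2)[OF D h' 2(1) that] 2(1) that
      by (simp add: divisor_of_inner)
    have ends: "on_edge h e 0 = on_edge h' e 0" "on_edge h e (len e) = on_edge h' e (len e)"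
      unfolding edge(2,3) edge'(2,3) by (rule refl)+
    have t: "t \<in> {0..len e}"
      using 2(2) by auto
    have "on_edge h e t = on_edge h' e t"
      by (rule edge_unique[OF edge(1) edge'(1) len_pos[OF 2(1)] ends _ t]) (rule bends)
    with 2 show ?thesis
      by simp
  qed
qed

text \<open>
  The edge solutions are chosen independently for both orientations of an edge. That they agree is
  a consequence of uniqueness, applied to one of them and to the reversal of the other.
\<close>

lemma admissible_extension_exists:
  assumes D: "mdivisor G arev len D"
  shows "\<exists>h. admissible_extension D f h"
proof -
  have "\<forall>e\<in>arcs G. \<exists>g. piecewise_integral_affine (len e) g \<and> g 0 = f (tail G e) \<and>
      g (len e) = f (head G e) \<and> edge_admissible (len e) (\<lambda>t. on_edge D e t + bend (len e) g t)"
  proof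
    fix e assume e: "e \<in> arcs G"
    show "\<exists>g. piecewise_integral_affine (len e) g \<and> g 0 = f (tail G e) \<and>
        g (len e) = f (head G e) \<and> edge_admissible (len e) (\<lambda>t. on_edge D e t + bend (len e) g t)"
      by (rule edge_exists[OF len_pos[OF e] mdivisor_on_edge_finite[OF D e]])
  qed
  then obtain F where "\<forall>e\<in>arcs G. piecewise_integral_affine (len e) (F e) \<and> F e 0 = f (tail G e) \<and>
      F e (len e) = f (head G e) \<and> edge_admissible (len e) (\<lambda>t. on_edge D e t + bend (len e) (F e) t)"
    by (rule bchoice[THEN exE])
  then have F: "\<And>e. e \<in> arcs G \<Longrightarrow> piecewise_integral_affine (len e) (F e)"
      "\<And>e. e \<in> arcs G \<Longrightarrow> F e 0 = f (tail G e)" "\<And>e. e \<in> arcs G \<Longrightarrow> F e (len e) = f (head G e)"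
      "\<And>e. e \<in> arcs G \<Longrightarrow> edge_admissible (len e) (\<lambda>t. on_edge D e t + bend (len e) (F e) t)"
    by blast+
  have rev: "F (arev e) (len e - t) = F e t" if e: "e \<in> arcs G" and t: "t \<in> {0..len e}" for e t
  proof -
    let ?g = "\<lambda>t. F (arev e) (len e - t)"
    have e': "arev e \<in> arcs G" "len (arev e) = len e"
      using e len_arev by auto
    have g: "piecewise_integral_affine (len e) ?g"
      using F(1)[OF e'(1)] e'(2) by (intro piecewise_integral_affine_reverse) simp
    have ends: "?g 0 = F e 0" "?g (len e) = F e (len e)"
      using F(2,3)[OF e'(1)] F(2,3)[OF e] e by (simp_all add: e'(2))
    have D_rev: "on_edge D (arev e) (len e - t) = on_edge D e t" for t
      using point_arev[OF e] by simp
    have "bend (len e) (F (arev e)) (len e - t) = bend (len e) ?g t" for t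
      using bend_reverse[of "len e" "F (arev e)" "len e - t"] by simp
    then have adm: "edge_admissible (len e) (\<lambda>t. on_edge D e t + bend (len e) ?g t)"
      using edge_admissible_reverse[OF F(4)[OF e'(1)]] by (simp add: e'(2) D_rev)
    note fin = mdivisor_on_edge_finite[OF D e]
    \<comment> \<open>Both are admissible with the same boundary values, so the division prescribes the same bends.\<close>
    have "bend (len e) ?g s = bend (len e) (F e) s" if "s \<in> {0<..<len e}" for s
      using edge_admissible_imp[OF g len_pos[OF e] fin adm, unfolded ends]
        edge_admissible_imp[OF F(1)[OF e] len_pos[OF e] fin F(4)[OF e]] that
      by (metis add_left_cancel)
    then show ?thesis
      using edge_unique[OF g F(1)[OF e] len_pos[OF e] ends _ t] by blast
  qed
  obtain h where h: "h \<in> extensional (mpoints G arev len)" "extends G f h"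
    "\<And>e t. e \<in> arcs G \<Longrightarrow> t \<in> {0..len e} \<Longrightarrow> on_edge h e t = F e t"
    using glue_edge_functions[of F f] F(2,3) rev by metis
  have pia: "piecewise_integral_affine (len e) (on_edge h e)" if "e \<in> arcs G" for e
    using F(1)[OF that] h(3)[OF that] piecewise_integral_affine_cong[of "len e" "F e"] by simp
  have "continuous_map (mtopology G arev len) euclideanreal h"
    using pia len_pos by (intro continuous_map_mtopologyI piecewise_integral_affine_continuous_on)
  with h(1) pia have rat: "h \<in> rational_functions G arev len"
    by (simp add: rational_functions_def)
  have "bend (len e) (on_edge h e) t = bend (len e) (F e) t"
    if e: "e \<in> arcs G" and t: "t \<in> {0<..<len e}" for e t
    using h(3)[OF e] t by (intro bend_cong) auto
  then have "edge_admissible (len e) (\<lambda>t. on_edge D e t + bend (len e) (on_edge h e) t)"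
    if e: "e \<in> arcs G" for e
    using F(4)[OF e] e by (simp add: edge_admissible_def)
  with rat h(2) show ?thesis
    by (auto simp: admissible_extension_def admissible_iff_edge_admissible[OF D])
qed

end

theorem theorem5p5:
  fixes G :: "('a, 'b) pre_digraph" and arev :: "'b \<Rightarrow> 'b" and len :: "'b \<Rightarrow> real"
    and D :: "('a, 'b) mpoint \<Rightarrow> int" and f :: "'a \<Rightarrow> real"
  assumes "fin_digraph G" and "bidirected_digraph G arev"
    and "\<And>e. e \<in> arcs G \<Longrightarrow> len e > 0"
    and "\<And>e. e \<in> arcs G \<Longrightarrow> len (arev e) = len e"
    and "mdivisor G arev len D"
  shows
    "(\<exists>!fh. fh \<in> rational_functions G arev len \<and> extends G f fh \<and>
        admissible G arev len (\<lambda>x. D x + divisor_of G arev len fh x)) \<and>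
     (\<forall>fh. fh \<in> rational_functions G arev len \<and> extends G f fh \<and>
        admissible G arev len (\<lambda>x. D x + divisor_of G arev len fh x) \<longrightarrow>
        (\<forall>h\<in>rational_functions G arev len. extends G f h \<longrightarrow>
          (h = fh \<longleftrightarrow>
            (\<forall>u\<in>verts G. \<forall>e\<in>arcs G. tail G e = u \<longrightarrow>
               incoming_slope G arev len h e 0 =
                 \<lfloor>(f (tail G e) - f (head G e) + twister G arev len D e) / len e\<rfloor>) \<and>
            (\<forall>e\<in>arcs G. \<forall>t\<in>{0<..<len e}.
               D (pt G arev len e t) + divisor_of G arev len h (pt G arev len e t) =
                 (if len e - t = (f (tail G e) - f (head G e) + twister G arev len D e) rmod len e
                  then 1 else 0)))))"
proof -
  interpret metric_graph G arev len
    using assms(1-4) by (simp add: metric_graph_def metric_graph_axioms_def)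
  note D = assms(5)
  let ?slope = "\<lambda>h. \<forall>u\<in>verts G. \<forall>e\<in>arcs G. tail G e = u \<longrightarrow> incoming_slope G arev len h e 0 =
    \<lfloor>(f (tail G e) - f (head G e) + twister G arev len D e) / len e\<rfloor>"
  let ?div = "\<lambda>h. \<forall>e\<in>arcs G. \<forall>t\<in>{0<..<len e}.
    D (pt G arev len e t) + divisor_of G arev len h (pt G arev len e t) =
      (if len e - t = (f (tail G e) - f (head G e) + twister G arev len D e) rmod len e
       then 1 else 0)"
  have "\<exists>!fh. admissible_extension D f fh"
    using admissible_extension_exists[OF D] admissible_extension_unique[OF D] by blast
  moreover have "h = fh \<longleftrightarrow> ?slope h \<and> ?div h"
    if fh: "admissible_extension D f fh" and h: "h \<in> rational_functions G arev len" "extends G f h"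
    for fh h
  proof
    assume "h = fh"
    then show "?slope h \<and> ?div h"
      using admissible_extension_slope_and_divisor[OF D fh] by blast
  next
    assume "?slope h \<and> ?div h"
    then have "admissible_extension D f h"
      using h by (intro admissible_extensionI[OF D]) auto
    then show "h = fh"
      using fh by (rule admissible_extension_unique[OF D])
  qed
  ultimately show ?thesis
    unfolding admissible_extension_def by blast
qed

end
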